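(* Let $Z^\pi(s,a)$ be the true cost return of policy $\pi$ at a state-action pair $(s,a)$, an integrable real-valued random variable with quantile function $F^{-1}_{Z^\pi(s,a)}$, and let $\tau\mapsto Z_\psi(s,a;\tau)$, $\tau\in[0,1]$, be an integrable measurable real-valued function (the approximation of the quantile function given by a network with parameters $\psi$). Let $\delta\ge 0$ be defined by $$\delta^2 := \mathbb{E}_{\tau\sim\mathrm{Unif}[0,1]}\left[\left|F^{-1}_{Z^\pi(s,a)}(\tau)-Z_\psi(s,a;\tau)\right|^2\right],$$ assumed finite. Then for every risk level $\epsilon\in(0,1)$, $$\left|\mathrm{CVaR}_\epsilon(Z^\pi(s,a))-\mathrm{CVaR}_\epsilon(Z_\psi(s,a))\right|\le\frac{\delta}{\sqrt{\epsilon}}.$$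
   Context: In a constrained Markov decision process with cost function $c$ and discount factor $\gamma\in[0,1)$, the cost return $Z^\pi(s,a)$ is the random variable $\sum_{t\ge 0}\gamma^t c(s_t,a_t)$ when starting from $s_0=s$, $a_0=a$ and following policy $\pi$ thereafter; here $(s,a)$ is fixed and $Z^\pi(s,a)$ is treated simply as a real-valued random variable. For a random variable $Z$ with cumulative distribution function $F_Z$, the quantile function is $F_Z^{-1}(\tau)=\inf\{z: F_Z(z)\ge\tau\}$ and $\mathrm{CVaR}_\epsilon(Z)=\frac1\epsilon\int_{1-\epsilon}^1F_Z^{-1}(\tau)\,d\tau$. For the approximation, $Z_\psi(s,a;\tau)$ is the estimated $\tau$-quantile and $\mathrm{CVaR}_\epsilon(Z_\psi(s,a))=\frac1\epsilon\int_{1-\epsilon}^1 Z_\psi(s,a;\tau)\,d\tau$. *)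

theory Defs
  imports "HOL-Probability.Probability"
begin

(* The infimum is taken in the reals. For 0 < t < 1 the set is nonempty and bounded below, so
   this is the usual quantile. At the endpoints t = 0 and t = 1, where the textbook value may be
   infinite, the value may be unspecified; these two points form a null set and do not affect any
   integral over t. *)
definition quantile :: "'w measure \<Rightarrow> ('w \<Rightarrow> real) \<Rightarrow> real \<Rightarrow> real" where
  "quantile M Z t = Inf {z. t \<le> cdf (distr M borel Z) z}"

(* CVaR of a return that is given only through a (possibly approximate, not necessarily
   monotone) quantile function q on [0,1]. *)
definition CVaR_quantile :: "real \<Rightarrow> (real \<Rightarrow> real) \<Rightarrow> real" where
  "CVaR_quantile \<epsilon> q = 1 / \<epsilon> * (LINT t:{1 - \<epsilon>..1}|lborel. q t)"

definition CVaR :: "'w measure \<Rightarrow> real \<Rightarrow> ('w \<Rightarrow> real) \<Rightarrow> real" where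
  "CVaR M \<epsilon> Z = CVaR_quantile \<epsilon> (quantile M Z)"

end

theory Submission
  imports Defs
begin

text \<open>
  On \<open>[0,1]\<close> the difference \<open>f\<close> of the two quantile functions is square-integrable, hence
  integrable, and the two CVaR values differ by \<open>1/\<epsilon>\<close> times the integral of \<open>f\<close> over
  \<open>[1 - \<epsilon>, 1]\<close>. By Cauchy-Schwarz this integral is at most \<open>sqrt \<epsilon> * \<delta>\<close> in absolute value.
\<close>

text \<open>Expanding \<open>(\<bar>y\<bar> - 1)\<^sup>2\<close> shows that
  \<open>1 + y\<^sup>2\<close> dominates the absolute value of \<open>y\<close>, and the constant 1
  is integrable because \<open>A\<close> has finite measure.\<close>

lemma set_integrable_of_power2:
  fixes f :: "'a \<Rightarrow> real"
  assumes "A \<in> sets M" "emeasure M A < \<infinity>"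
    and "set_borel_measurable M A f" "set_integrable M A (\<lambda>x. (f x)\<^sup>2)"
  shows "set_integrable M A f"
proof (rule set_integrable_bound)
  have "set_integrable M A (\<lambda>_. 1 :: real)"
    using assms by (simp add: set_integrable_def)
  then show "set_integrable M A (\<lambda>x. 1 + (f x)\<^sup>2)"
    using assms(4) by (rule set_integral_add)
  have "\<bar>y\<bar> \<le> 1 + y\<^sup>2" for y :: real
    using zero_le_power2[of "\<bar>y\<bar> - 1"] by (simp add: power2_diff)
  then show "AE x in M. x \<in> A \<longrightarrow> norm (f x) \<le> norm (1 + (f x)\<^sup>2)"
    by (simp add: abs_of_nonneg)
qed fact

text \<open>This is Cauchy-Schwarz against the constant 1, obtained from nonnegativity of the
  variance: \<open>a\<close> is the mean of \<open>f\<close> over \<open>A\<close>, the constant for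
  which the integral of \<open>(f x - a)\<^sup>2\<close> is smallest.\<close>

lemma set_integral_power2_le:
  fixes f :: "'a \<Rightarrow> real"
  assumes A: "A \<in> sets M" "emeasure M A < \<infinity>" "0 < measure M A"
    and f: "set_integrable M A f" and f2: "set_integrable M A (\<lambda>x. (f x)\<^sup>2)"
  shows "(LINT x:A|M. f x)\<^sup>2 \<le> measure M A * (LINT x:A|M. (f x)\<^sup>2)"
proof -
  define m where "m = measure M A"
  define S where "S = (LINT x:A|M. f x)"
  define a where "a = S / m"
  have const: "set_integrable M A (\<lambda>_. c)" "(LINT x:A|M. c) = m * c" for c :: real
    using A by (simp_all add: set_integrable_def set_lebesgue_integral_def m_def)
  have "0 \<le> (LINT x:A|M. (f x - a)\<^sup>2)"
    unfolding set_lebesgue_integral_def by (rule Bochner_Integration.integral_nonneg) simp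
  also have "\<dots> = (LINT x:A|M. ((f x)\<^sup>2 + a\<^sup>2) - 2 * a * f x)"
    by (simp add: power2_diff mult_ac)
  also have "\<dots> = (LINT x:A|M. (f x)\<^sup>2) + m * a\<^sup>2 - 2 * a * S"
    using f f2 const by (simp add: S_def)
  also have "\<dots> = (LINT x:A|M. (f x)\<^sup>2) - S\<^sup>2 / m"
    using A(3) by (simp add: a_def m_def power2_eq_square field_simps)
  finally show ?thesis
    using A(3) by (simp add: S_def m_def field_simps)
qed

text \<open>A density of the form \<open>ennreal\<close> of a real function is what the rules for
  Bochner integrals with respect to \<open>density\<close> expect.\<close>

lemma uniform_measure_eq_density:
  assumes "emeasure M A \<noteq> 0" "emeasure M A \<noteq> \<infinity>"
  shows "uniform_measure M A = density M (\<lambda>x. ennreal (indicator A x / measure M A))"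
proof -
  have "0 < measure M A"
    using assms by (simp add: measure_def enn2real_positive_iff less_top zero_less_iff_neq_zero)
  then have "indicator A x / emeasure M A = ennreal (indicator A x / measure M A)" for x
    using assms by (simp add: emeasure_eq_ennreal_measure divide_ennreal[symmetric] ennreal_indicator)
  then show ?thesis
    by (simp add: uniform_measure_def)
qed

text \<open>These move the hypotheses on a uniform \<open>t\<close> to Lebesgue measure. The
  indicator occurs twice, once in the density and once in the set integral, and is idempotent; what
  remains is division by the nonzero constant \<open>measure M A\<close>.\<close>

lemma
  fixes f :: "'a \<Rightarrow> real"
  assumes A: "A \<in> sets M" "emeasure M A \<noteq> 0" "emeasure M A \<noteq> \<infinity>"
    and f: "set_borel_measurable M A f"
  shows set_integrable_uniform_measure_iff:
      "set_integrable (uniform_measure M A) A f \<longleftrightarrow> set_integrable M A f"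
    and set_integral_uniform_measure:
      "(LINT x:A|uniform_measure M A. f x) = (LINT x:A|M. f x) / measure M A"
proof -
  have m: "measure M A \<noteq> 0"
    using A by (simp add: measure_def enn2real_eq_0_iff)
  have eq: "indicator A x * (indicator A x * f x) = indicator A x * f x" for x
    by (simp split: split_indicator)
  show "set_integrable (uniform_measure M A) A f \<longleftrightarrow> set_integrable M A f"
    using A f m unfolding set_integrable_def set_borel_measurable_def uniform_measure_eq_density[OF A(2,3)]
    by (subst integrable_real_density)
      (simp_all add: eq, simp add: divide_inverse)
  show "(LINT x:A|uniform_measure M A. f x) = (LINT x:A|M. f x) / measure M A"
    using A f unfolding set_lebesgue_integral_def set_borel_measurable_def uniform_measure_eq_density[OF A(2,3)]
    by (subst integral_real_density) (simp_all add: eq)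
qed

lemma set_borel_measurable_quantile:
  assumes "prob_space M" "Z \<in> borel_measurable M"
  shows "set_borel_measurable lborel {0..1} (quantile M Z)"
proof -
  interpret M: prob_space M by fact
  interpret D: real_distribution "distr M borel Z"
    using assms(2) by simp
  interpret D: cdf_distribution "distr M borel Z" ..
  \<comment> \<open>On the open unit interval \<open>quantile M Z\<close> is the monotone
    pseudo-inverse of the cdf, hence measurable there.\<close>
  have "quantile M Z \<in> borel_measurable (restrict_space borel {0<..<1})"
    using D.measurable_CI by (simp add: quantile_def[abs_def])
  then have "(\<lambda>t. indicator {0<..<1} t *\<^sub>R quantile M Z t) \<in> borel_measurable borel"
    by (simp add: borel_measurable_restrict_space_iff)
  \<comment> \<open>The endpoints, where the infimum may be an unspecified value, form a countable
    set and cannot spoil measurability.\<close>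
  then have "(\<lambda>t. indicator {0..1} t *\<^sub>R quantile M Z t) \<in> borel_measurable borel"
    by (rule measurable_discrete_difference[where X="{0, 1}"]) (auto split: split_indicator)
  then show ?thesis
    by (simp add: set_borel_measurable_def)
qed

theorem theorem3p1:
  fixes M :: "'w measure" and Z :: "'w \<Rightarrow> real" and Z\<psi> :: "real \<Rightarrow> real" and \<delta> \<epsilon> :: real
  assumes "prob_space M"
    and "integrable M Z"
    and "set_integrable lborel {0..1} Z\<psi>"
    and "set_integrable (uniform_measure lborel {0..1}) {0..1} (\<lambda>t. \<bar>quantile M Z t - Z\<psi> t\<bar>\<^sup>2)"
    and "\<delta> \<ge> 0"
    and "\<delta>\<^sup>2 = (LINT t:{0..1}|uniform_measure lborel {0..1}. \<bar>quantile M Z t - Z\<psi> t\<bar>\<^sup>2)"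
    and "0 < \<epsilon>" and "\<epsilon> < 1"
  shows "\<bar>CVaR M \<epsilon> Z - CVaR_quantile \<epsilon> Z\<psi>\<bar> \<le> \<delta> / sqrt \<epsilon>"
proof -
  let ?f = "\<lambda>t. quantile M Z t - Z\<psi> t"
  let ?I = "{0..1 :: real}" and ?J = "{1 - \<epsilon>..1}"
  have J: "?J \<subseteq> ?I" using \<open>\<epsilon> < 1\<close> by auto
  have q: "set_borel_measurable lborel ?I (quantile M Z)"
    using assms by (intro set_borel_measurable_quantile) auto
  have "set_borel_measurable lborel ?I Z\<psi>"
    using assms(3) by (auto simp: set_integrable_def set_borel_measurable_def)
  with q have f: "set_borel_measurable lborel ?I ?f"
    unfolding set_borel_measurable_def by (simp add: right_diff_distrib)
  \<comment> \<open>Only the product of \<open>?f\<close> with the indicator is known to be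
    measurable, so that product is squared.\<close>
  have "(\<lambda>t. (indicator ?I t *\<^sub>R ?f t)\<^sup>2) \<in> borel_measurable lborel"
    using f unfolding set_borel_measurable_def by (rule borel_measurable_power)
  also have "(\<lambda>t. (indicator ?I t *\<^sub>R ?f t)\<^sup>2) = (\<lambda>t. indicator ?I t *\<^sub>R (?f t)\<^sup>2)"
    by (auto split: split_indicator)
  finally have f2: "set_borel_measurable lborel ?I (\<lambda>t. (?f t)\<^sup>2)"
    by (simp add: set_borel_measurable_def)
  have int_f2: "set_integrable lborel ?I (\<lambda>t. (?f t)\<^sup>2)"
    using assms(4) set_integrable_uniform_measure_iff[OF _ _ _ f2] by simp
  have \<delta>: "\<delta>\<^sup>2 = (LINT t:?I|lborel. (?f t)\<^sup>2)"
    using assms(6) set_integral_uniform_measure[OF _ _ _ f2] by simp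
  have "set_integrable lborel ?I ?f"
    using set_integrable_of_power2[OF _ _ f int_f2] by simp
  then have int_J: "set_integrable lborel ?J ?f" "set_integrable lborel ?J (\<lambda>t. (?f t)\<^sup>2)"
    "set_integrable lborel ?J Z\<psi>"
    using int_f2 assms(3) J by (simp_all add: set_integrable_subset[where A="?I"])
  \<comment> \<open>The integrand is nonnegative, so enlarging \<open>?J\<close> to
    \<open>?I\<close> can only increase the integral.\<close>
  have "(LINT t:?J|lborel. (?f t)\<^sup>2) \<le> \<delta>\<^sup>2"
    unfolding \<delta> using int_J(2) int_f2 J
    unfolding set_lebesgue_integral_def set_integrable_def
    by (intro integral_mono) (auto split: split_indicator)
  \<comment> \<open>The factor \<open>\<epsilon>\<close> is the length of \<open>?J\<close>; its
    square root survives the final division by \<open>\<epsilon>\<close> as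
    \<open>1 / sqrt \<epsilon>\<close>.\<close>
  then have "(LINT t:?J|lborel. ?f t)\<^sup>2 \<le> \<epsilon> * \<delta>\<^sup>2"
    using set_integral_power2_le[OF _ _ _ int_J(1,2)] \<open>0 < \<epsilon>\<close>
    by (simp add: order_trans[OF _ mult_left_mono])
  also have "\<dots> = (sqrt \<epsilon> * \<delta>)\<^sup>2"
    using \<open>0 < \<epsilon>\<close> by (simp add: power_mult_distrib)
  finally have le: "\<bar>LINT t:?J|lborel. ?f t\<bar> \<le> sqrt \<epsilon> * \<delta>"
    using \<open>\<delta> \<ge> 0\<close> \<open>0 < \<epsilon>\<close> by (simp add: power2_le_iff_abs_le)
  \<comment> \<open>Integrability over \<open>?J\<close> has been shown for \<open>?f\<close> and
    \<open>Z\<psi>\<close>, so the quantile function is written as their sum before its integral is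
    split.\<close>
  have "(LINT t:?J|lborel. quantile M Z t) = (LINT t:?J|lborel. ?f t + Z\<psi> t)"
    by simp
  also have "\<dots> = (LINT t:?J|lborel. ?f t) + (LINT t:?J|lborel. Z\<psi> t)"
    using int_J(1,3) by (rule set_integral_add)
  finally have "\<bar>CVaR M \<epsilon> Z - CVaR_quantile \<epsilon> Z\<psi>\<bar> = \<bar>LINT t:?J|lborel. ?f t\<bar> / \<epsilon>"
    using \<open>0 < \<epsilon>\<close> by (simp add: CVaR_def CVaR_quantile_def add_divide_distrib)
  also have "\<dots> \<le> sqrt \<epsilon> * \<delta> / \<epsilon>"
    using le \<open>0 < \<epsilon>\<close> by (intro divide_right_mono) auto
  also have "\<dots> = \<delta> / sqrt \<epsilon>"
    using \<open>0 < \<epsilon>\<close> by (simp add: frac_eq_eq mult_ac)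
  finally show ?thesis .
qed

end
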